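(* Let $H_D,H$ be Hilbert spaces with inner products $(\cdot,\cdot)_D$, $(\cdot,\cdot)$ and associated norms $\|\cdot\|_D$, $\|\cdot\|$. Let $T:H_D\to H$ be a bounded (linear) operator that is bounded below: $\|Tx\|\ge C_1\|x\|_D$ for all $x\in H_D$, for some $C_1>0$. Let $T_c:H_D\to H$ be a compact (linear) operator. Assume $\mathrm{Ker}(T+T_c)=\{0\}$. Then there exists $C_0>0$ such that for all $x\in H_D$ $$\|\{T+T_c\}x\|\ge C_0\left(\|Tx\|+\|T_cx\|\right).$$ *)

theory Defs
  imports "HOL-Analysis.Analysis"
begin

text \<open>The scalar field of a Hilbert space, treated uniformly for \<open>\<real>\<close> and \<open>\<complex>\<close>.  By Gelfand--Mazur
  these are, up to isomorphism, the only instances.\<close>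

class rc_field = real_normed_field +
  fixes conj :: "'a \<Rightarrow> 'a"
  assumes conj_add: "conj (a + b) = conj a + conj b"
    and conj_mult: "conj (a * b) = conj a * conj b"
    and conj_conj: "conj (conj a) = a"
    and mult_conj: "a * conj a = (norm a)\<^sup>2 *\<^sub>R 1"

instantiation real :: rc_field
begin
definition conj_real :: "real \<Rightarrow> real" where "conj_real x = x"
instance by standard (auto simp: conj_real_def power2_eq_square)
end

instantiation complex :: rc_field
begin
definition conj_complex :: "complex \<Rightarrow> complex" where "conj_complex = cnj"
instance by standard
  (simp_all add: conj_complex_def scaleR_conv_of_real complex_norm_square [symmetric])
end

text \<open>Completeness with respect to the norm comes from the sort of \<open>'a\<close>.  The axiom \<open>ip_self\<close> says
  that the norm of \<open>'a\<close> is the one induced by \<open>ip\<close>; it also makes \<open>ip\<close> positive definite.\<close>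

locale hilbert_space = vector_space scale
  for scale :: "'k::rc_field \<Rightarrow> 'a::{real_normed_vector, complete_space} \<Rightarrow> 'a" +
  fixes ip :: "'a \<Rightarrow> 'a \<Rightarrow> 'k"
  assumes scale_of_real: "scale (of_real r) x = r *\<^sub>R x"
    and ip_add_left: "ip (x + y) z = ip x z + ip y z"
    and ip_scale_left: "ip (scale c x) y = c * ip x y"
    and ip_conj: "ip y x = conj (ip x y)"
    and ip_self: "ip x x = of_real ((norm x)\<^sup>2)"

lemma hilbert_space_real_inner:
  "hilbert_space scaleR (inner :: 'a::{real_inner, complete_space} \<Rightarrow> 'a \<Rightarrow> real)"
  by unfold_locales
    (simp_all add: scaleR_add_right scaleR_add_left inner_add_left inner_add_right conj_real_def
      power2_norm_eq_inner inner_commute)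

lemma hilbert_space_complex: "hilbert_space (*) (\<lambda>x y :: complex. x * cnj y)"
  by unfold_locales
    (simp_all add: distrib_left distrib_right mult.assoc conj_complex_def scaleR_conv_of_real
      complex_norm_square [symmetric] mult.commute [of "cnj _"])

definition bounded_operator ::
  "('k::field \<Rightarrow> 'a::real_normed_vector \<Rightarrow> 'a) \<Rightarrow> ('k \<Rightarrow> 'b::real_normed_vector \<Rightarrow> 'b) \<Rightarrow> ('a \<Rightarrow> 'b) \<Rightarrow> bool"
  where "bounded_operator s1 s2 T \<longleftrightarrow>
    Vector_Spaces.linear s1 s2 T \<and> (\<exists>K. \<forall>x. norm (T x) \<le> K * norm x)"

definition compact_operator ::
  "('k::field \<Rightarrow> 'a::real_normed_vector \<Rightarrow> 'a) \<Rightarrow> ('k \<Rightarrow> 'b::real_normed_vector \<Rightarrow> 'b) \<Rightarrow> ('a \<Rightarrow> 'b) \<Rightarrow> bool"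
  where "compact_operator s1 s2 T \<longleftrightarrow>
    Vector_Spaces.linear s1 s2 T \<and> (\<forall>S. bounded S \<longrightarrow> compact (closure (T ` S)))"

end

theory Submission imports Defs begin

text \<open>The point is that \<open>T + T\<^sub>c\<close> is itself bounded below; since \<open>T\<close> and \<open>T\<^sub>c\<close> are bounded,
  \<open>\<parallel>T x\<parallel> + \<parallel>T\<^sub>c x\<parallel>\<close> is at most a multiple of \<open>\<parallel>x\<parallel>\<close>, hence at most a multiple of
  \<open>\<parallel>T x + T\<^sub>c x\<parallel>\<close>.

  If \<open>T + T\<^sub>c\<close> were not bounded below, there would be unit vectors \<open>x\<^sub>n\<close> with
  \<open>T x\<^sub>n + T\<^sub>c x\<^sub>n \<rightarrow> 0\<close>. By compactness \<open>T\<^sub>c x\<^sub>n\<close> converges along a subsequence, so \<open>T x\<^sub>n\<close> does too.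
  Because \<open>T\<close> is bounded below, convergence of \<open>T x\<^sub>n\<close> forces \<open>x\<^sub>n\<close> to be Cauchy along that
  subsequence, and its limit is a unit vector in the kernel of \<open>T + T\<^sub>c\<close>. This is
  \<open>bounded_below_compact_perturbation\<close>. The argument only sees norms and limits, so the
  scalars may be restricted to \<open>\<real>\<close>.\<close>

lemma linear_imp_real_linear:
  assumes "hilbert_space s1 ip1" and "hilbert_space s2 ip2" and "Vector_Spaces.linear s1 s2 f"
  shows "linear f"
proof -
  interpret f: Vector_Spaces.linear s1 s2 f by fact
  show ?thesis
  proof (rule linearI)
    show "f (x + y) = f x + f y" for x y by (rule f.add)
    show "f (r *\<^sub>R x) = r *\<^sub>R f x" for r x
      using f.scale[of "of_real r" x] assms(1,2)[THEN hilbert_space.scale_of_real] by simp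
  qed
qed

lemma bounded_operator_imp_bounded_linear:
  assumes "hilbert_space s1 ip1" and "hilbert_space s2 ip2" and "bounded_operator s1 s2 f"
  shows "bounded_linear f"
proof -
  have "linear f"
    using assms linear_imp_real_linear unfolding bounded_operator_def by blast
  moreover obtain B where "\<And>x. norm (f x) \<le> B * norm x"
    using assms(3) unfolding bounded_operator_def by blast
  ultimately show ?thesis
    by (intro bounded_linear.intro bounded_linear_axioms.intro)
      (auto intro!: exI[of _ B] simp: mult.commute)
qed

lemma bounded_linear_if_bounded_on_sphere:
  assumes "linear f" and "bounded (f ` sphere 0 1)"
  shows "bounded_linear f"
proof -
  obtain B where B: "\<And>x. norm x = 1 \<Longrightarrow> norm (f x) \<le> B"
    using assms(2) unfolding bounded_iff by force
  have "norm (f x) \<le> norm x * B" for x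
  proof (cases "x = 0")
    case False
    with B[of "x /\<^sub>R norm x"] show ?thesis
      by (simp add: linear_scale[OF assms(1)] field_simps)
  qed (simp add: linear_0[OF assms(1)])
  with assms(1) show ?thesis
    by (intro bounded_linear.intro bounded_linear_axioms.intro) auto
qed

lemma compact_operator_compact_image_sphere:
  assumes "compact_operator s1 s2 f"
  shows "compact (closure (f ` sphere 0 1))"
proof -
  have image: "compact (closure (f ` S))" if "bounded S" for S
    using assms that unfolding compact_operator_def by blast
  show ?thesis
    by (rule image[OF bounded_subset[OF bounded_cball sphere_cball]])
qed

lemma compact_operator_imp_bounded_linear:
  assumes "hilbert_space s1 ip1" and "hilbert_space s2 ip2" and "compact_operator s1 s2 f"
  shows "bounded_linear f"
proof (rule bounded_linear_if_bounded_on_sphere)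
  show "linear f"
    using assms linear_imp_real_linear unfolding compact_operator_def by blast
  have "compact (closure (f ` sphere 0 1))"
    using assms(3) by (rule compact_operator_compact_image_sphere)
  then show "bounded (f ` sphere 0 1)"
    by (rule bounded_subset[OF compact_imp_bounded closure_subset])
qed

text \<open>A linear map that is bounded below reflects Cauchy sequences, so convergence of the images
  passes back to a complete domain. Compactness of \<open>T\<^sub>c\<close> controls only images; this lemma
  recovers a limit of the unit vectors themselves.\<close>

lemma convergent_if_bounded_below:
  fixes T :: "'d::{real_normed_vector, complete_space} \<Rightarrow> 'h::real_normed_vector"
  assumes "linear T" and "c > 0" and below: "\<And>x. c * norm x \<le> norm (T x)"
    and "convergent (\<lambda>n. T (x n))"
  shows "convergent x"
proof -
  have "Cauchy (\<lambda>n. T (x n))"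
    using assms(4) by (rule convergent_Cauchy)
  have "Cauchy x"
  proof (rule CauchyI)
    fix e :: real assume "e > 0"
    with \<open>c > 0\<close> have "c * e > 0" by simp
    then obtain M where M: "\<And>m n. m \<ge> M \<Longrightarrow> n \<ge> M \<Longrightarrow> norm (T (x m) - T (x n)) < c * e"
      using CauchyD[OF \<open>Cauchy (\<lambda>n. T (x n))\<close>] by blast
    have "norm (x m - x n) < e" if "m \<ge> M" "n \<ge> M" for m n
    proof -
      have "c * norm (x m - x n) \<le> norm (T (x m) - T (x n))"
        using below[of "x m - x n"] by (simp add: linear_diff[OF assms(1)])
      also have "\<dots> < c * e" using M that .
      finally show ?thesis using \<open>c > 0\<close> by simp
    qed
    then show "\<exists>M. \<forall>m\<ge>M. \<forall>n\<ge>M. norm (x m - x n) < e" by blast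
  qed
  then show ?thesis by (rule Cauchy_convergent)
qed

text \<open>By homogeneity a failure of the bound can be normalised to unit vectors, which is why the
  compactness hypothesis concerns the sphere; continuity of the norm keeps their limit away from \<open>0\<close>.\<close>

lemma bounded_below_compact_perturbation:
  fixes T K :: "'d::{real_normed_vector, complete_space} \<Rightarrow> 'h::real_normed_vector"
  assumes T: "bounded_linear T" and K: "bounded_linear K"
    and "c > 0" and below: "\<And>x. c * norm x \<le> norm (T x)"
    and compact: "compact (closure (K ` sphere 0 1))"
    and ker: "\<And>x. T x + K x = 0 \<Longrightarrow> x = 0"
  shows "\<exists>e>0. \<forall>x. e * norm x \<le> norm (T x + K x)"
proof (rule ccontr)
  assume contra: "\<not> ?thesis"
  interpret S: bounded_linear "\<lambda>x. T x + K x"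
    using T K by (rule bounded_linear_add)
  have "\<exists>x. norm x = 1 \<and> norm (T x + K x) < inverse (real (Suc n))" for n
  proof -
    obtain y where y: "norm (T y + K y) < inverse (real (Suc n)) * norm y"
      using contra[simplified, rule_format, of "inverse (real (Suc n))"] by (auto simp: not_le)
    then have "y \<noteq> 0" using S.zero by auto
    have "norm (T (y /\<^sub>R norm y) + K (y /\<^sub>R norm y)) = norm (T y + K y) / norm y"
      by (simp only: S.scaleR) (simp add: divide_inverse mult.commute)
    also have "\<dots> < inverse (real (Suc n))"
      using y \<open>y \<noteq> 0\<close> by (simp add: divide_less_eq)
    finally show ?thesis using \<open>y \<noteq> 0\<close> by (intro exI[of _ "y /\<^sub>R norm y"]) simp
  qed
  then obtain x where unit: "\<And>n. norm (x n) = 1"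
    and small: "\<And>n. norm (T (x n) + K (x n)) < inverse (real (Suc n))"
    by metis
  have S_lim: "(\<lambda>n. T (x n) + K (x n)) \<longlonglongrightarrow> 0"
    by (rule Lim_null_comparison[OF always_eventually LIMSEQ_inverse_real_of_nat])
      (use small less_imp_le in blast)
  have "K (x n) \<in> closure (K ` sphere 0 1)" for n
    using unit[of n] by (intro subsetD[OF closure_subset] imageI) simp
  then obtain l r where r: "strict_mono (r :: nat \<Rightarrow> nat)"
    and K_lim: "(\<lambda>n. K (x (r n))) \<longlonglongrightarrow> l"
    using seq_compactE[OF compact_imp_seq_compact[OF compact], of "\<lambda>n. K (x n)"]
    unfolding o_def by blast
  have S_sub: "(\<lambda>n. T (x (r n)) + K (x (r n))) \<longlonglongrightarrow> 0"
    using LIMSEQ_subseq_LIMSEQ[OF S_lim r] by (simp add: o_def)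
  have "(\<lambda>n. T (x (r n))) \<longlonglongrightarrow> 0 - l"
    using tendsto_diff[OF S_sub K_lim] by simp
  then have "convergent (\<lambda>n. x (r n))"
    by (intro convergent_if_bounded_below[OF bounded_linear.linear[OF T] \<open>c > 0\<close> below])
      (rule convergentI)
  then obtain z where z: "(\<lambda>n. x (r n)) \<longlonglongrightarrow> z"
    by (auto simp: convergent_def)
  have "T z + K z = 0"
    using LIMSEQ_unique[OF S.tendsto[OF z] S_sub] .
  then have "z = 0" by (rule ker)
  moreover have "norm z = 1"
    using LIMSEQ_unique[OF tendsto_norm[OF z]] unit by simp
  ultimately show False by simp
qed

theorem lemma16:
  fixes scaleD :: "'k::rc_field \<Rightarrow> 'd::{real_normed_vector, complete_space} \<Rightarrow> 'd"
    and ipD :: "'d \<Rightarrow> 'd \<Rightarrow> 'k"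
    and scaleH :: "'k \<Rightarrow> 'h::{real_normed_vector, complete_space} \<Rightarrow> 'h"
    and ipH :: "'h \<Rightarrow> 'h \<Rightarrow> 'k"
    and T Tc :: "'d \<Rightarrow> 'h"
    and C1 :: real
  assumes "hilbert_space scaleD ipD"
    and "hilbert_space scaleH ipH"
    and "bounded_operator scaleD scaleH T"
    and "C1 > 0"
    and "\<And>x. norm (T x) \<ge> C1 * norm x"
    and "compact_operator scaleD scaleH Tc"
    and "{x. T x + Tc x = 0} = {0}"
  shows "\<exists>C0>0. \<forall>x. norm (T x + Tc x) \<ge> C0 * (norm (T x) + norm (Tc x))"
proof -
  have T: "bounded_linear T"
    using assms(1-3) by (rule bounded_operator_imp_bounded_linear)
  have Tc: "bounded_linear Tc"
    using assms(1,2,6) by (rule compact_operator_imp_bounded_linear)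
  have "compact (closure (Tc ` sphere 0 1))"
    using assms(6) by (rule compact_operator_compact_image_sphere)
  moreover have "x = 0" if "T x + Tc x = 0" for x
    using assms(7) that by auto
  ultimately have "\<exists>e>0. \<forall>x. e * norm x \<le> norm (T x + Tc x)"
    by (rule bounded_below_compact_perturbation[OF T Tc assms(4,5)])
  then obtain e where "e > 0" and e: "\<And>x. e * norm x \<le> norm (T x + Tc x)"
    by blast
  obtain A where "A > 0" and A: "\<And>x. norm (T x) \<le> norm x * A"
    using bounded_linear.pos_bounded[OF T] by blast
  obtain B where "B > 0" and B: "\<And>x. norm (Tc x) \<le> norm x * B"
    using bounded_linear.pos_bounded[OF Tc] by blast
  have "e / (A + B) * (norm (T x) + norm (Tc x)) \<le> norm (T x + Tc x)" for x
  proof -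
    have "e / (A + B) * (norm (T x) + norm (Tc x)) \<le> e / (A + B) * ((A + B) * norm x)"
      using A[of x] B[of x] \<open>e > 0\<close> \<open>A > 0\<close> \<open>B > 0\<close>
      by (intro mult_left_mono) (simp_all add: algebra_simps)
    also have "\<dots> = e * norm x" using \<open>A > 0\<close> \<open>B > 0\<close> by simp
    also have "\<dots> \<le> norm (T x + Tc x)" by (rule e)
    finally show ?thesis .
  qed
  moreover have "e / (A + B) > 0" using \<open>e > 0\<close> \<open>A > 0\<close> \<open>B > 0\<close> by simp
  ultimately show ?thesis by blast
qed

end
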